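(* Let $G$ be a finite graph. Then $G$ is sign-invertible if and only if $|\det(G)|=1$ and, for any two vertices $x$ and $y$ of $G$ (they may be the same vertex), $$\Big|\sum_{P\in \mathcal P_{xy}} (-1)^{|E(P)|}\det(G-V(P))\Big|\in\{0,1\},$$ where $\mathcal P_{xy}$ is the set of all feasible $(x,y)$-paths of $G$.
   Context: Graphs have no multiple edges but may have loops (a loop at $i$ gives the diagonal entry $a_{ii}=1$ of the adjacency matrix and is regarded as a cycle of length one). For a graph $G$ with adjacency matrix $A$, write $\det(G)=\det(A)$; for the empty graph (no vertices) set $\det(G)=1$. $G$ is invertible if $A$ is invertible, and sign-invertible if $A$ is invertible and every entry of $A^{-1}$ lies in $\{-1,0,1\}$ (that is, the inverse is the adjacency matrix of a signed graph, possibly with loops). A perfect 2-matching of a graph is a spanning subgraph each of whose components is either a cycle or a single edge ($K_2$); the empty graph has the empty perfect 2-matching. An $(x,y)$-path is a path joining $x$ and $y$ (if $x=y$ it is the single vertex $x$, with no edges). An $(x,y)$-path $P$ of $G$ is feasible if $G-V(P)$ has a perfect 2-matching. *)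

theory Defs
  imports
    "Graph_Theory.Graph_Theory"
    "Jordan_Normal_Form.Determinant"
begin

text \<open>
  As in the AFP entry Graph_Theory, an undirected graph is a symmetric digraph: an edge
  between distinct \<open>u\<close> and \<open>v\<close> is the pair of arcs \<open>(u, v)\<close>, \<open>(v, u)\<close>, and a loop at \<open>u\<close> is the
  single arc \<open>(u, u)\<close>. Finite graphs with loops but without multiple edges are those satisfying
  both \<^const>\<open>pseudo_graph\<close> and \<^const>\<open>nomulti_digraph\<close>.
\<close>

definition vertex_enum :: "('a, 'b) pre_digraph \<Rightarrow> 'a list" where
  "vertex_enum G = (SOME vs. distinct vs \<and> set vs = verts G)"

text \<open>
  Another enumeration of the vertices conjugates the matrix by a permutation matrix,
  which affects neither the determinant nor the set of entries of the inverse.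
\<close>

definition adjacency_mat :: "('a, 'b) pre_digraph \<Rightarrow> real mat" where
  "adjacency_mat G = (let vs = vertex_enum G; n = length vs in
     mat n n (\<lambda>(i, j). if vs ! i \<rightarrow>\<^bsub>G\<^esub> vs ! j then 1 else 0))"

definition graph_det :: "('a, 'b) pre_digraph \<Rightarrow> real" where
  "graph_det G = det (adjacency_mat G)"

definition sign_invertible :: "('a, 'b) pre_digraph \<Rightarrow> bool" where
  "sign_invertible G \<longleftrightarrow>
     (\<exists>B. inverts_mat (adjacency_mat G) B \<and> inverts_mat B (adjacency_mat G) \<and>
          elements_mat B \<subseteq> {-1, 0, 1})"

text \<open>
  Length 2 is excluded because in a symmetric digraph it would describe a single edge;
  length 1 describes a loop.
\<close>

definition cycle_graph :: "('a, 'b) pre_digraph \<Rightarrow> bool" where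
  "cycle_graph C \<longleftrightarrow>
     (\<exists>vs. distinct vs \<and> (length vs = 1 \<or> length vs \<ge> 3) \<and> verts C = set vs \<and>
        arcs_ends C = set (zip vs (rotate1 vs)) \<union> (set (zip vs (rotate1 vs)))\<inverse>)"

text \<open>
  In a symmetric digraph the strongly connected components are the connected components.
\<close>

definition perfect_2_matching :: "('a, 'b) pre_digraph \<Rightarrow> ('a, 'b) pre_digraph \<Rightarrow> bool" where
  "perfect_2_matching H G \<longleftrightarrow> spanning H G \<and> symmetric H \<and>
     (\<forall>C \<in> pre_digraph.sccs H. cycle_graph C \<or> K\<^bsub>2\<^esub> C)"

definition delete_verts :: "('a, 'b) pre_digraph \<Rightarrow> 'a set \<Rightarrow> ('a, 'b) pre_digraph" where
  "delete_verts G S = G \<restriction> (verts G - S)"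

text \<open>
  For fixed ends \<open>x\<close> and \<open>y\<close>, a path is determined by, and identified with, the list of its
  vertices in order from \<open>x\<close> to \<open>y\<close>; it has \<^const>\<open>vwalk_length\<close> edges.
\<close>

definition feasible_paths :: "('a, 'b) pre_digraph \<Rightarrow> 'a \<Rightarrow> 'a \<Rightarrow> 'a list set" where
  "feasible_paths G x y =
     {p. vpath p G \<and> hd p = x \<and> last p = y \<and> (\<exists>M. perfect_2_matching M (delete_verts G (set p)))}"

end

theory Submission
  imports Defs "HOL-Combinatorics.Orbits"
begin

text \<open>
  The \<open>(x, y)\<close> entry of the adjugate of \<open>A\<close> is the sum of \<open>(-1) ^ |E(P)| * det (G - V(P))\<close> over
  all \<open>(x, y)\<close>-paths \<open>P\<close>: expanding along the row of \<open>x\<close> chooses the second vertex of the path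
  and deletes \<open>x\<close> from the graph. Infeasible paths contribute nothing, because a nonzero
  determinant has a nonzero Leibniz term, and the orbits of its permutation are the components of a
  perfect 2-matching. The inverse being the adjugate divided by the determinant, it remains to see
  that a sign-invertible graph has determinant \<open>\<plusminus>1\<close>: both \<open>A\<close> and its inverse have integer
  determinants, with product 1.
\<close>

section \<open>Determinants indexed by finite sets\<close>

text \<open>The Leibniz formula over an arbitrary finite index set: deleting vertices only shrinks
  \<open>S\<close>, with no renumbering of minors. For empty \<open>S\<close> it gives 1, in
  agreement with the convention for the empty graph.\<close>

definition set_det :: "'a set \<Rightarrow> ('a \<Rightarrow> 'a \<Rightarrow> 'b::comm_ring_1) \<Rightarrow> 'b" where
  "set_det S a = (\<Sum>p | p permutes S. of_int (sign p) * (\<Prod>i\<in>S. a i (p i)))"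

text \<open>Curried, so that \<open>a(y := unit_row u)\<close> puts the standard basis vector at
  \<open>u\<close> into row \<open>y\<close>.\<close>

definition unit_row :: "'a \<Rightarrow> 'a \<Rightarrow> 'b::zero_neq_one" where
  "unit_row u v = (if u = v then 1 else 0)"

lemma set_det_cong:
  assumes "\<And>i j. i \<in> S \<Longrightarrow> j \<in> S \<Longrightarrow> a i j = b i j"
  shows "set_det S a = set_det S b"
  unfolding set_det_def
  by (intro sum.cong arg_cong2[where f = "(*)"] prod.cong refl assms)
     (auto simp: permutes_in_image)

text \<open>Conjugation by \<open>f\<close> is a bijection between the permutations of
  \<open>A\<close> and those of \<open>B\<close>, and it preserves signs.\<close>

lemma set_det_reindex:
  assumes f: "bij_betw f A B" and "finite A"
  shows "set_det B a = set_det A (\<lambda>i j. a (f i) (f j))"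
proof -
  have inj: "inj_on f A" and B: "B = f ` A"
    using f by (auto simp: bij_betw_def)
  have "bij_betw (map_permutation A f) {p. p permutes A} {p. p permutes B}"
  proof (rule bij_betw_byWitness[where f' = "map_permutation B (inv_into A f)"])
    show "\<forall>p\<in>{p. p permutes A}. map_permutation B (inv_into A f) (map_permutation A f p) = p"
      using map_permutation_compose_inv[OF f] inj by auto
    show "\<forall>p\<in>{p. p permutes B}. map_permutation A f (map_permutation B (inv_into A f) p) = p"
      using map_permutation_compose_inv[OF bij_betw_inv_into[OF f]] f
      by (auto simp: bij_betw_inv_into_right)
    show "map_permutation A f ` {p. p permutes A} \<subseteq> {p. p permutes B}"
      using map_permutation_permutes[OF f] by auto
    show "map_permutation B (inv_into A f) ` {p. p permutes B} \<subseteq> {p. p permutes A}"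
      using map_permutation_permutes[OF bij_betw_inv_into[OF f]] by auto
  qed
  then have "set_det B a = (\<Sum>p | p permutes A. of_int (sign (map_permutation A f p)) *
      (\<Prod>i\<in>B. a i (map_permutation A f p i)))"
    unfolding set_det_def by (rule sum.reindex_bij_betw[symmetric])
  also have "\<dots> = set_det A (\<lambda>i j. a (f i) (f j))"
    unfolding set_det_def B using inj \<open>finite A\<close>
    by (intro sum.cong) (auto simp: sign_map_permutation prod.reindex map_permutation_apply)
  finally show ?thesis .
qed

text \<open>Linearity in row \<open>y\<close>: in the term of a permutation \<open>p\<close>, only
  the unit row at \<open>u = p y\<close> survives.\<close>

lemma set_det_row_expand:
  assumes "finite S" "y \<in> S"
  shows "set_det S a = (\<Sum>u\<in>S. a y u * set_det S (a(y := unit_row u)))"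
proof -
  have "(\<Sum>u\<in>S. a y u * set_det S (a(y := unit_row u))) =
    (\<Sum>p | p permutes S. \<Sum>u\<in>S. a y u * (of_int (sign p) * (\<Prod>i\<in>S. (a(y := unit_row u)) i (p i))))"
    unfolding set_det_def sum_distrib_left by (rule sum.swap)
  also have "\<dots> = set_det S a"
    unfolding set_det_def
  proof (intro sum.cong refl)
    fix p assume "p \<in> {p. p permutes S}"
    then have p: "p y \<in> S" using \<open>y \<in> S\<close> by (simp add: permutes_in_image)
    have row: "(\<Prod>i\<in>S. (a(y := r)) i (p i)) = r (p y) * (\<Prod>i\<in>S - {y}. a i (p i))" for r
      using assms by (subst prod.remove[of S y]) (auto intro!: prod.cong)
    have "(\<Sum>u\<in>S. a y u * (of_int (sign p) * (\<Prod>i\<in>S. (a(y := unit_row u)) i (p i)))) =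
      (\<Sum>u\<in>S. if u = p y then a y u * (of_int (sign p) * (\<Prod>i\<in>S - {y}. a i (p i))) else 0)"
      unfolding row by (intro sum.cong) (auto simp: unit_row_def)
    also have "\<dots> = of_int (sign p) * (\<Prod>i\<in>S. a i (p i))"
      using p assms by (simp add: prod.remove[of S y] mult_ac)
    finally show "(\<Sum>u\<in>S. a y u * (of_int (sign p) * (\<Prod>i\<in>S. (a(y := unit_row u)) i (p i)))) =
      of_int (sign p) * (\<Prod>i\<in>S. a i (p i))" .
  qed
  finally show ?thesis ..
qed

text \<open>Composing every permutation with the transposition of \<open>x\<close> and
  \<open>y\<close> restores the products and flips the signs.\<close>

lemma set_det_swap_rows:
  assumes "finite S" "x \<in> S" "y \<in> S" "x \<noteq> y"
  shows "set_det S (a(x := a y, y := a x)) = - set_det S a"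
proof -
  let ?t = "transpose x y"
  have t: "?t permutes S" using assms by (simp add: permutes_swap_id)
  have "set_det S (a(x := a y, y := a x)) =
    (\<Sum>p | p permutes S. of_int (sign (p \<circ> ?t)) * (\<Prod>i\<in>S. (a(x := a y, y := a x)) i ((p \<circ> ?t) i)))"
    unfolding set_det_def by (rule sum_permutations_compose_right[OF t])
  also have "\<dots> = (\<Sum>p | p permutes S. - (of_int (sign p) * (\<Prod>i\<in>S. a i (p i))))"
  proof (intro sum.cong refl)
    fix p assume "p \<in> {p. p permutes S}"
    then have "permutation p" using \<open>finite S\<close> by (auto simp: permutation_permutes)
    then have "sign (p \<circ> ?t) = - sign p"
      using \<open>x \<noteq> y\<close> by (simp add: sign_compose sign_swap_id permutation_swap_id)
    moreover have "(\<Prod>i\<in>S. (a(x := a y, y := a x)) i ((p \<circ> ?t) i)) = (\<Prod>i\<in>S. a i (p i))"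
      using assms by (subst prod.reindex_bij_betw[OF permutes_imp_bij[OF t], symmetric])
        (auto intro!: prod.cong simp: transpose_def)
    ultimately show "of_int (sign (p \<circ> ?t)) * (\<Prod>i\<in>S. (a(x := a y, y := a x)) i ((p \<circ> ?t) i)) =
      - (of_int (sign p) * (\<Prod>i\<in>S. a i (p i)))" by simp
  qed
  also have "\<dots> = - set_det S a"
    by (simp add: set_det_def sum_negf)
  finally show ?thesis .
qed

text \<open>Swapping the two rows changes nothing, so the determinant is its own negative; in an
  ordered domain this forces 0.\<close>

lemma set_det_equal_rows:
  fixes a :: "'a \<Rightarrow> 'a \<Rightarrow> 'b::linordered_idom"
  assumes "finite S" "x \<in> S" "y \<in> S" "x \<noteq> y" "a x = a y"
  shows "set_det S a = 0"
proof -
  have "a(x := a y, y := a x) = a" using \<open>a x = a y\<close> by auto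
  then show ?thesis using set_det_swap_rows[OF assms(1-4), of a] by simp
qed

text \<open>A permutation moving \<open>x\<close> meets a zero of the unit row; those fixing
  \<open>x\<close> are the permutations of \<open>S - {x}\<close>, with the same signs.\<close>

lemma set_det_unit_row_diag:
  assumes "finite S" "x \<in> S"
  shows "set_det S (a(x := unit_row x)) = set_det (S - {x}) a"
proof -
  let ?h = "\<lambda>p. of_int (sign p) * (\<Prod>i\<in>S. (a(x := unit_row x)) i (p i))"
  have *: "?h p = (if p x = x then of_int (sign p) * (\<Prod>i\<in>S - {x}. a i (p i)) else 0)" for p
  proof -
    have "(\<Prod>i\<in>S - {x}. (a(x := unit_row x)) i (p i)) = (\<Prod>i\<in>S - {x}. a i (p i))"
      by (intro prod.cong) auto
    then show ?thesis
      using assms by (auto simp: prod.remove[of S x] unit_row_def)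
  qed
  have sub: "{p. p permutes S - {x}} \<subseteq> {p. p permutes S}"
    by (auto intro: permutes_subset)
  have "(\<Sum>p | p permutes S - {x}. ?h p) = (\<Sum>p | p permutes S. ?h p)"
  proof (rule sum.mono_neutral_left)
    show "\<forall>p\<in>{p. p permutes S} - {p. p permutes S - {x}}. ?h p = 0"
    proof
      fix p assume "p \<in> {p. p permutes S} - {p. p permutes S - {x}}"
      then have "p x \<noteq> x" by (auto intro: permutes_superset)
      then show "?h p = 0" unfolding * by simp
    qed
  qed (use assms sub in \<open>auto simp: finite_permutations\<close>)
  moreover have "(\<Sum>p | p permutes S - {x}. ?h p) = set_det (S - {x}) a"
    unfolding set_det_def * by (intro sum.cong) (auto simp: permutes_not_in)
  ultimately show ?thesis by (simp add: set_det_def)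
qed

text \<open>
  Replacing row \<open>y\<close> by the unit row at \<open>x\<close> gives the \<open>(y, x)\<close> cofactor, that is the \<open>(x, y)\<close>
  entry of the adjugate, with no sign depending on an enumeration.
\<close>

lemma set_det_adjugate:
  fixes a :: "'a \<Rightarrow> 'a \<Rightarrow> 'b::linordered_idom"
  assumes "finite S" "x \<in> S" "y \<in> S"
  shows "(\<Sum>u\<in>S. a x u * set_det S (a(y := unit_row u))) = (if x = y then set_det S a else 0)"
proof -
  \<comment> \<open>Row \<open>y\<close> is overwritten by row \<open>x\<close>: two rows agree if
    \<open>x \<noteq> y\<close>, and nothing changes otherwise.\<close>
  have "set_det S (a(y := a x)) = (\<Sum>u\<in>S. a x u * set_det S (a(y := unit_row u)))"
    using set_det_row_expand[OF assms(1,3), of "a(y := a x)"] by simp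
  moreover have "set_det S (a(y := a x)) = 0" if "x \<noteq> y"
    using set_det_equal_rows[of S x y "a(y := a x)"] assms that by simp
  ultimately show ?thesis by (cases "x = y") auto
qed

text \<open>
  Expand row \<open>x\<close>, then swap rows \<open>x\<close> and \<open>y\<close>: this produces the sign, and row \<open>x\<close> becomes
  the unit row at \<open>x\<close>, which deletes \<open>x\<close> from the index set.
\<close>

lemma set_det_adjugate_rec:
  fixes a :: "'a \<Rightarrow> 'a \<Rightarrow> 'b::linordered_idom"
  assumes "finite S" "x \<in> S" "y \<in> S" "x \<noteq> y"
  shows "set_det S (a(y := unit_row x)) =
    - (\<Sum>u\<in>S - {x}. a x u * set_det (S - {x}) (a(y := unit_row u)))"
proof -
  have minor: "set_det S (a(y := unit_row x, x := unit_row u)) =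
    (if u = x then 0 else - set_det (S - {x}) (a(y := unit_row u)))" for u
  \<comment> \<open>For \<open>u = x\<close> rows \<open>x\<close> and \<open>y\<close> coincide,
    which removes \<open>x\<close> from the range of summation.\<close>
  proof (cases "u = x")
    case True
    then show ?thesis using set_det_equal_rows[OF assms, of "a(y := unit_row x, x := unit_row x)"] assms(4) by simp
  next
    case False
    have "(a(y := unit_row x, x := unit_row u)) =
      (let b = a(y := unit_row u, x := unit_row x) in b(x := b y, y := b x))"
      using \<open>x \<noteq> y\<close> by (auto simp: Let_def)
    then have "set_det S (a(y := unit_row x, x := unit_row u)) =
      - set_det S (a(y := unit_row u, x := unit_row x))"
      by (simp only: Let_def set_det_swap_rows[OF assms])
    then show ?thesis using False assms by (simp add: set_det_unit_row_diag)
  qed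
  have "set_det S (a(y := unit_row x)) =
    (\<Sum>u\<in>S. a x u * set_det S (a(y := unit_row x, x := unit_row u)))"
    using set_det_row_expand[OF assms(1,2), of "a(y := unit_row x)"] assms by simp
  also have "\<dots> = (\<Sum>u\<in>S - {x}. a x u * - set_det (S - {x}) (a(y := unit_row u)))"
    unfolding minor using assms by (subst sum.remove[of S x]) (auto intro!: sum.cong)
  finally show ?thesis by (simp add: sum_negf)
qed

section \<open>Expanding the adjugate over paths\<close>

text \<open>Arc relation and vertex set are separate arguments, so that a recursion can shrink
  \<open>S\<close> while \<open>r\<close> stays fixed.\<close>

definition paths_on :: "('a \<times> 'a) set \<Rightarrow> 'a set \<Rightarrow> 'a \<Rightarrow> 'a \<Rightarrow> 'a list set" where
  "paths_on r S x y = {p. distinct p \<and> set p \<subseteq> S \<and> p \<noteq> [] \<and> hd p = x \<and> last p = y \<and>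
     set (vwalk_arcs p) \<subseteq> r}"

lemma finite_paths_on:
  assumes "finite S"
  shows "finite (paths_on r S x y)"
  by (rule finite_subset[OF _ finite_subset_distinct[OF assms]]) (auto simp: paths_on_def)

lemma paths_on_same:
  assumes "x \<in> S"
  shows "paths_on r S x x = {[x]}"
proof -
  have "p = [x]" if "p \<in> paths_on r S x x" for p
  proof (cases p)
    case (Cons z q)
    then show ?thesis using that by (cases "q = []") (auto simp: paths_on_def)
  qed (use that in \<open>simp add: paths_on_def\<close>)
  then show ?thesis using assms by (auto simp: paths_on_def)
qed

text \<open>By distinctness, dropping the first vertex leaves a path that avoids it; the shape
  matches \<open>set_det_adjugate_rec\<close>.\<close>

lemma paths_on_rec:
  assumes "x \<in> S" "x \<noteq> y"
  shows "paths_on r S x y = (\<Union>u\<in>{u \<in> S - {x}. (x, u) \<in> r}. (#) x ` paths_on r (S - {x}) u y)"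
proof (intro equalityI subsetI)
  fix p assume p: "p \<in> paths_on r S x y"
  then obtain q where q: "p = x # q" by (cases p) (auto simp: paths_on_def)
  with p \<open>x \<noteq> y\<close> have "q \<noteq> []" by (auto simp: paths_on_def)
  with p q have "hd q \<in> S - {x}" "(x, hd q) \<in> r" "q \<in> paths_on r (S - {x}) (hd q) y"
    by (auto simp: paths_on_def)
  with q show "p \<in> (\<Union>u\<in>{u \<in> S - {x}. (x, u) \<in> r}. (#) x ` paths_on r (S - {x}) u y)" by blast
next
  fix p assume "p \<in> (\<Union>u\<in>{u \<in> S - {x}. (x, u) \<in> r}. (#) x ` paths_on r (S - {x}) u y)"
  then show "p \<in> paths_on r S x y" using assms by (auto simp: paths_on_def)
qed

text \<open>Cofactors and signed path sums obey the same recursion: stepping from \<open>x\<close>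
  to \<open>u\<close> deletes \<open>x\<close> and costs one minus sign. The induction on
  \<open>S\<close> therefore varies \<open>x\<close> and fixes \<open>y\<close>.\<close>

lemma set_det_adjugate_paths:
  fixes a :: "'a \<Rightarrow> 'a \<Rightarrow> 'b::linordered_idom"
  assumes "\<And>u v. a u v = (if (u, v) \<in> r then 1 else 0)"
  assumes "finite S" "x \<in> S" "y \<in> S"
  shows "set_det S (a(y := unit_row x)) =
    (\<Sum>p\<in>paths_on r S x y. (-1) ^ vwalk_length p * set_det (S - set p) a)"
  using assms(2-)
proof (induction S arbitrary: x rule: finite_psubset_induct)
  case (psubset S)
  show ?case
  proof (cases "x = y")
    case True
    then show ?thesis
      using psubset.hyps psubset.prems set_det_unit_row_diag[of S y a]
      by (simp add: paths_on_same fun_upd_def)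
  next
    case False
    let ?S = "S - {x}"
    let ?U = "{u \<in> ?S. (x, u) \<in> r}"
    have IH: "set_det ?S (a(y := unit_row u)) =
      (\<Sum>p\<in>paths_on r ?S u y. (-1) ^ vwalk_length p * set_det (?S - set p) a)" if "u \<in> ?S" for u
      using psubset that False by (intro psubset.IH) auto
    \<comment> \<open>Paths are grouped by their second vertex \<open>u\<close>, so the groups are
      disjoint.\<close>
    have "(\<Sum>p\<in>paths_on r S x y. (-1) ^ vwalk_length p * set_det (S - set p) a) =
      (\<Sum>u\<in>?U. \<Sum>p\<in>(#) x ` paths_on r ?S u y. (-1) ^ vwalk_length p * set_det (S - set p) a)"
      unfolding paths_on_rec[OF \<open>x \<in> S\<close> False]
      by (rule sum.UNION_disjoint)
         (use psubset.hyps in \<open>auto simp: finite_paths_on\<close>, auto simp: paths_on_def)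
    also have "\<dots> = (\<Sum>u\<in>?U. - set_det ?S (a(y := unit_row u)))"
    proof (intro sum.cong refl)
      fix u assume u: "u \<in> ?U"
      have "(\<Sum>p\<in>(#) x ` paths_on r ?S u y. (-1) ^ vwalk_length p * set_det (S - set p) a) =
        (\<Sum>p\<in>paths_on r ?S u y. - ((-1) ^ vwalk_length p * set_det (?S - set p) a))"
      proof (subst sum.reindex, simp, intro sum.cong refl)
        fix p assume "p \<in> paths_on r ?S u y"
        \<comment> \<open>Nonemptiness matters: \<open>vwalk_length\<close> is 0 both for the empty
          list and for a single vertex.\<close>
        then have "p \<noteq> []" by (simp add: paths_on_def)
        then have "(-1) ^ vwalk_length (x # p) = - ((-1::'b) ^ vwalk_length p)"
          by (cases p) auto
        moreover have "S - set (x # p) = ?S - set p" by auto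
        ultimately show "((\<lambda>p. (-1) ^ vwalk_length p * set_det (S - set p) a) \<circ> (#) x) p =
          - ((-1) ^ vwalk_length p * set_det (?S - set p) a)"
          by (simp del: vwalk_length_simp)
      qed
      also have "\<dots> = - set_det ?S (a(y := unit_row u))"
        using u by (subst IH) (auto simp: sum_negf)
      finally show "(\<Sum>p\<in>(#) x ` paths_on r ?S u y. (-1) ^ vwalk_length p * set_det (S - set p) a) =
        - set_det ?S (a(y := unit_row u))" .
    qed
    also have "\<dots> = - (\<Sum>u\<in>?S. a x u * set_det ?S (a(y := unit_row u)))"
    proof -
      have "(\<Sum>u\<in>?U. set_det ?S (a(y := unit_row u))) =
        (\<Sum>u\<in>?S. if (x, u) \<in> r then set_det ?S (a(y := unit_row u)) else 0)"
        using psubset.hyps by (intro sum.inter_filter) auto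
      also have "\<dots> = (\<Sum>u\<in>?S. a x u * set_det ?S (a(y := unit_row u)))"
        unfolding assms(1)[of x] by (intro sum.cong) auto
      finally show ?thesis by (simp add: sum_negf)
    qed
    finally show ?thesis
      unfolding set_det_adjugate_rec[OF psubset.hyps psubset.prems False] by (rule sym)
  qed
qed

section \<open>Perfect 2-matchings from permutations\<close>

text \<open>Listing \<open>x\<close>, \<open>f x\<close>, ... up to the first return turns one step
  of \<open>f\<close> into a cyclic shift, the form in which \<open>cycle_graph\<close> describes
  cycles.\<close>

lemma rotate1_orbit_list:
  assumes "x \<in> orbit f x"
  obtains vs where "distinct vs" "set vs = orbit f x" "rotate1 vs = map f vs"
proof
  let ?n = "funpow_dist1 f x x"
  let ?vs = "map (\<lambda>i. (f ^^ i) x) [0..<?n]"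
  show "distinct ?vs"
    using inj_on_funpow_dist1[OF assms] by (simp add: distinct_map del: upt_Suc)
  show "set ?vs = orbit f x"
    using orbit_conv_funpow_dist1[OF assms] by (simp del: upt_Suc)
  show "rotate1 ?vs = map f ?vs"
  proof (rule nth_equalityI)
    fix i assume "i < length (rotate1 ?vs)"
    then have i: "i < ?n" by (simp del: upt_Suc)
    show "rotate1 ?vs ! i = map f ?vs ! i"
    proof (cases "Suc i = ?n")
      \<comment> \<open>The last position wraps around to position 0, where the first return to
        \<open>x\<close> closes the cycle.\<close>
      case True
      then show ?thesis
        using i funpow_dist1_prop[OF assms] by (simp add: nth_rotate1 del: upt_Suc)
    next
      case False
      then show ?thesis using i by (simp add: nth_rotate1 del: upt_Suc)
    qed
  qed simp
qed

lemma set_zip_map: "set (zip xs (map f xs)) = (\<lambda>u. (u, f u)) ` set xs"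
  by (induction xs) auto

text \<open>A fixed point of \<open>p\<close> gives a loop, an orbit of size 2 a single edge, and a
  longer orbit a cycle.\<close>

lemma perfect_2_matching_permutes:
  fixes G :: "('a, 'b) pre_digraph"
  assumes "pseudo_graph G" and "nomulti_digraph G"
    and p: "p permutes verts G" and dom: "\<And>v. v \<in> verts G \<Longrightarrow> v \<rightarrow>\<^bsub>G\<^esub> p v"
  shows "\<exists>M. perfect_2_matching M G"
proof -
  interpret pseudo_graph G by fact
  interpret nomulti_digraph G by fact
  \<comment> \<open>Both directions of each arc from \<open>v\<close> to \<open>p v\<close> are
    kept, which makes \<open>M\<close> symmetric.\<close>
  define M where "M = G\<lparr>arcs := {e \<in> arcs G. head G e = p (tail G e) \<or> tail G e = p (head G e)}\<rparr>"
  have M [simp]: "verts M = verts G" "tail M = tail G" "head M = head G"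
    "arcs M = {e \<in> arcs G. head G e = p (tail G e) \<or> tail G e = p (head G e)}"
    by (simp_all add: M_def)
  have perm: "permutation p"
    using p finite_verts unfolding permutation_permutes by blast
  have sym: "(v, u) \<in> arcs_ends G" if "(u, v) \<in> arcs_ends G" for u v
    using sym_arcs that by (auto simp: symmetric_def dest: symD)
  have ends: "(u, v) \<in> arcs_ends M \<longleftrightarrow> u \<in> verts G \<and> v \<in> verts G \<and> (v = p u \<or> u = p v)" for u v
  proof
    assume "(u, v) \<in> arcs_ends M"
    then obtain e where "e \<in> arcs G" "tail G e = u" "head G e = v" "v = p u \<or> u = p v"
      by (auto simp: arcs_ends_conv)
    then show "u \<in> verts G \<and> v \<in> verts G \<and> (v = p u \<or> u = p v)"
      using tail_in_verts head_in_verts by metis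
  next
    assume *: "u \<in> verts G \<and> v \<in> verts G \<and> (v = p u \<or> u = p v)"
    then have "(u, v) \<in> arcs_ends G" using dom sym by auto
    then show "(u, v) \<in> arcs_ends M" using * by (force simp: arcs_ends_conv)
  qed
  interpret M: wf_digraph M by unfold_locales auto
  have "subgraph M G"
    unfolding subgraph_def compatible_def using wf_digraph M.wf_digraph by auto
  then have "spanning M G" by (simp add: spanning_def)
  moreover have "symmetric M" unfolding symmetric_def by (rule symI) (auto simp: ends)
  moreover have "cycle_graph C \<or> K\<^bsub>2\<^esub> C" if scc: "C \<in> M.sccs" for C
  proof -
    obtain T where T: "T \<in> M.sccs_verts" and C: "C = M \<restriction> T"
      using scc M.sccs_conv_sccs_verts by auto
    then obtain x where x: "x \<in> T" by (auto simp: M.in_sccs_verts_conv_reachable)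
    have "x \<in> verts G"
      using T x M.reachable_in_verts[of x x] by (auto simp: M.in_sccs_verts_conv_reachable)
    \<comment> \<open>No arc of \<open>M\<close> leaves an orbit; conversely,
      \<open>orbit_reach\<close> walks along an orbit in both directions. Hence components and
      orbits coincide.\<close>
    have reach_orbit: "orbit p v = orbit p u" if "u \<rightarrow>\<^sup>*\<^bsub>M\<^esub> v" for u v
      using that
    proof (induction rule: M.reachable_induct)
      case (step v w)
      then show ?case using permutation_orbit_step[OF perm] ends[of v w] by auto
    qed auto
    have orbit_reach: "v \<rightarrow>\<^sup>*\<^bsub>M\<^esub> w \<and> w \<rightarrow>\<^sup>*\<^bsub>M\<^esub> v" if "w \<in> orbit p v" "v \<in> verts G" for v w
      using that
    proof induction
      case base
      then have "(v, p v) \<in> arcs_ends M" "(p v, v) \<in> arcs_ends M"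
        using permutes_in_image[OF p] by (auto simp: ends)
      then show ?case by (auto intro: M.reachable_adjI)
    next
      case (step w)
      then have "w \<in> verts G" using M.reachable_in_verts by auto
      then have "(w, p w) \<in> arcs_ends M" "(p w, w) \<in> arcs_ends M"
        using permutes_in_image[OF p] by (auto simp: ends)
      then show ?case using step
        by (auto intro: M.reachable_adj_trans M.adj_reachable_trans)
    qed
    have self: "v \<in> orbit p v" for v by (rule permutation_self_in_orbit[OF perm])
    have T_orbit: "T = orbit p x"
    proof (intro equalityI subsetI)
      fix v assume "v \<in> T"
      then have "x \<rightarrow>\<^sup>*\<^bsub>M\<^esub> v" using T x by (auto simp: M.in_sccs_verts_conv_reachable)
      then show "v \<in> orbit p x" using reach_orbit self by blast
    next
      fix v assume "v \<in> orbit p x"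
      then have "x \<rightarrow>\<^sup>*\<^bsub>M\<^esub> v" "v \<rightarrow>\<^sup>*\<^bsub>M\<^esub> x"
        using orbit_reach \<open>x \<in> verts G\<close> by blast+
      then show "v \<in> T" using T x by (auto simp: M.in_sccs_verts_conv_reachable)
    qed
    have T_verts: "T \<subseteq> verts G"
      unfolding T_orbit by (rule permutes_orbit_subset[OF p \<open>x \<in> verts G\<close>])
    obtain vs where vs: "distinct vs" "set vs = T" "rotate1 vs = map p vs"
      using rotate1_orbit_list[OF self] T_orbit by blast
    have pT: "p v \<in> T" if "v \<in> T" for v
      using that unfolding T_orbit by (rule orbit.step)
    have ends_C: "(u, v) \<in> arcs_ends C \<longleftrightarrow> u \<in> T \<and> v \<in> T \<and> (v = p u \<or> u = p v)" for u v
    proof -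
      have "(u, v) \<in> arcs_ends C \<longleftrightarrow> (u, v) \<in> arcs_ends M \<and> u \<in> T \<and> v \<in> T"
        unfolding C by (auto simp: arcs_ends_conv image_iff)
      then show ?thesis using T_verts by (auto simp: ends)
    qed
    have zip: "arcs_ends C = set (zip vs (rotate1 vs)) \<union> (set (zip vs (rotate1 vs)))\<inverse>"
      unfolding vs(3) set_zip_map vs(2) using pT by (auto simp: ends_C)
    show ?thesis
    \<comment> \<open>Length 2 is exactly what \<open>cycle_graph\<close> leaves out for a nonempty
      list; there the component must be shown to be complete on two vertices.\<close>
    proof (cases "length vs = 2")
      case False
      moreover have "length vs \<noteq> 0" using vs x by auto
      ultimately have "length vs = 1 \<or> length vs \<ge> 3" by linarith
      then show ?thesis
        using vs zip unfolding cycle_graph_def by (auto simp: C)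
    next
      case True
      then obtain u v where uv: "vs = [u, v]" by (auto simp: length_Suc_conv numeral_2_eq_2)
      have T_uv: "T = {u, v}" "u \<noteq> v" using vs(1,2) by (auto simp: uv)
      have p_uv: "p u = v" "p v = u" using vs(3)[symmetric] unfolding uv by simp_all
      \<comment> \<open>Since \<open>p\<close> swaps \<open>u\<close> and \<open>v\<close>, a loop
        of \<open>G\<close> at either of them is not an arc of \<open>M\<close>.\<close>
      have arcs: "arcs_ends C = {(u, v). (u, v) \<in> verts C \<times> verts C \<and> u \<noteq> v}"
      proof (rule Set.set_eqI)
        fix e :: "'a \<times> 'a"
        obtain w z where e: "e = (w, z)" by (cases e)
        have "w \<in> T \<and> z \<in> T \<and> (z = p w \<or> w = p z) \<longleftrightarrow> w \<in> T \<and> z \<in> T \<and> w \<noteq> z"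
          using T_uv p_uv by (metis insert_iff singletonD)
        then show "e \<in> arcs_ends C \<longleftrightarrow> e \<in> {(u, v). (u, v) \<in> verts C \<times> verts C \<and> u \<noteq> v}"
          unfolding e ends_C by (simp add: C)
      qed
      interpret C: wf_digraph C unfolding C by (rule M.wellformed_induce_subgraph)
      have "graph C"
      proof unfold_locales
        show "finite (verts C)" using T_uv by (simp add: C)
        show "finite (arcs C)" by (simp add: C)
        show "tail C e \<noteq> head C e" if "e \<in> arcs C" for e
          using arcs that by (auto simp: arcs_ends_conv)
        show "e1 = e2" if "e1 \<in> arcs C" "e2 \<in> arcs C" "arc_to_ends C e1 = arc_to_ends C e2" for e1 e2
          using that no_multi_arcs[of e1 e2] by (auto simp: C arc_to_ends_def)
        show "symmetric C" unfolding symmetric_def by (rule symI) (auto simp: arcs)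
      qed
      then have "K\<^bsub>2\<^esub> C" unfolding complete_digraph_def using arcs T_uv by (simp add: C)
      then show ?thesis ..
    qed
  qed
  ultimately show ?thesis unfolding perfect_2_matching_def by blast
qed

section \<open>The adjacency matrix\<close>

lemma det_mat_nth:
  assumes "distinct vs"
  shows "det (mat (length vs) (length vs) (\<lambda>(i, j). a (vs ! i) (vs ! j))) = set_det (set vs) a"
proof -
  have "bij_betw ((!) vs) {0..<length vs} (set vs)"
    using assms by (simp add: bij_betw_nth atLeast0LessThan)
  then have "set_det (set vs) a = set_det {0..<length vs} (\<lambda>i j. a (vs ! i) (vs ! j))"
    by (rule set_det_reindex) simp
  also have "\<dots> = det (mat (length vs) (length vs) (\<lambda>(i, j). a (vs ! i) (vs ! j)))"
    unfolding set_det_def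
    by (subst det_def'[where n = "length vs"])
       (auto intro!: sum.cong prod.cong arg_cong2[where f = "(*)"] simp: permutes_in_image)
  finally show ?thesis ..
qed

text \<open>The column index selects the replaced row and the row index the unit vector, since the
  adjugate is the transposed cofactor matrix.\<close>

lemma mat_nth_adjugate:
  fixes a :: "'a \<Rightarrow> 'a \<Rightarrow> 'b::linordered_field"
  assumes "distinct vs" and "set_det (set vs) a \<noteq> 0"
  defines "n \<equiv> length vs"
  shows "mat n n (\<lambda>(i, j). a (vs ! i) (vs ! j)) *
    mat n n (\<lambda>(i, j). set_det (set vs) (a(vs ! j := unit_row (vs ! i))) / set_det (set vs) a) = 1\<^sub>m n"
    (is "?A * ?B = _")
proof (rule eq_matI)
  fix i k assume "i < dim_row (1\<^sub>m n :: 'b mat)" "k < dim_col (1\<^sub>m n :: 'b mat)"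
  then have ik: "i < n" "k < n" by auto
  have bij: "bij_betw ((!) vs) {0..<n} (set vs)"
    using assms by (simp add: bij_betw_nth atLeast0LessThan)
  have "(?A * ?B) $$ (i, k) = (\<Sum>j\<in>{0..<n}. a (vs ! i) (vs ! j) *
      set_det (set vs) (a(vs ! k := unit_row (vs ! j))) / set_det (set vs) a)"
    using ik by (simp add: scalar_prod_def)
  also have "\<dots> = (\<Sum>u\<in>set vs. a (vs ! i) u *
      set_det (set vs) (a(vs ! k := unit_row u)) / set_det (set vs) a)"
    by (rule sum.reindex_bij_betw[OF bij])
  also have "\<dots> = (if vs ! i = vs ! k then set_det (set vs) a else 0) / set_det (set vs) a"
    using ik by (subst set_det_adjugate[symmetric]) (auto simp: sum_divide_distrib n_def)
  also have "\<dots> = 1\<^sub>m n $$ (i, k)"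
    using ik assms by (simp add: nth_eq_iff_index_eq)
  finally show "(?A * ?B) $$ (i, k) = 1\<^sub>m n $$ (i, k)" .
qed auto

definition adjacency :: "('a, 'b) pre_digraph \<Rightarrow> 'a \<Rightarrow> 'a \<Rightarrow> real" where
  "adjacency G u v = (if u \<rightarrow>\<^bsub>G\<^esub> v then 1 else 0)"

lemma vertex_enum:
  assumes "finite (verts G)"
  shows "distinct (vertex_enum G)" "set (vertex_enum G) = verts G"
proof -
  have "\<exists>vs. distinct vs \<and> set vs = verts G"
    using finite_distinct_list[OF assms] by auto
  then have "distinct (vertex_enum G) \<and> set (vertex_enum G) = verts G"
    unfolding vertex_enum_def by (rule someI_ex)
  then show "distinct (vertex_enum G)" "set (vertex_enum G) = verts G" by auto
qed

lemma adjacency_mat_alt: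
  "adjacency_mat G = mat (length (vertex_enum G)) (length (vertex_enum G))
    (\<lambda>(i, j). adjacency G (vertex_enum G ! i) (vertex_enum G ! j))"
  by (simp add: adjacency_mat_def adjacency_def Let_def)

lemma graph_det_eq_set_det:
  assumes "finite (verts G)"
  shows "graph_det G = set_det (verts G) (adjacency G)"
  unfolding graph_det_def adjacency_mat_alt
  using det_mat_nth[OF vertex_enum(1)[OF assms], of "adjacency G"] vertex_enum(2)[OF assms] by simp

text \<open>Passing to \<open>set_det\<close> avoids comparing the unrelated vertex enumerations of
  \<open>G\<close> and of the smaller graph.\<close>

lemma graph_det_delete_verts:
  assumes "finite (verts G)"
  shows "graph_det (delete_verts G S) = set_det (verts G - S) (adjacency G)"
proof -
  have "graph_det (delete_verts G S) = set_det (verts G - S) (adjacency (delete_verts G S))"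
    using assms by (subst graph_det_eq_set_det) (simp_all add: delete_verts_def)
  also have "\<dots> = set_det (verts G - S) (adjacency G)"
    by (rule set_det_cong) (auto simp: adjacency_def delete_verts_def arcs_ends_conv image_iff)
  finally show ?thesis .
qed

section \<open>Cofactors as sums over feasible paths\<close>

lemma perfect_2_matching_if_det_nonzero:
  assumes "pseudo_graph G" and "nomulti_digraph G" and "graph_det G \<noteq> 0"
  shows "\<exists>M. perfect_2_matching M G"
proof -
  interpret pseudo_graph G by fact
  \<comment> \<open>Some Leibniz term is nonzero, so none of its factors vanishes and
    \<open>p\<close> sends every vertex along an arc.\<close>
  from assms(3) obtain p where p: "p permutes verts G"
    and "(\<Prod>v\<in>verts G. adjacency G v (p v)) \<noteq> 0"
    unfolding graph_det_eq_set_det[OF finite_verts] set_det_def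
    by (metis (mono_tags, lifting) mem_Collect_eq mult_zero_right sum.neutral)
  then have "v \<rightarrow>\<^bsub>G\<^esub> p v" if "v \<in> verts G" for v
    using that finite_verts by (auto simp: adjacency_def split: if_splits)
  then show ?thesis by (rule perfect_2_matching_permutes[OF assms(1,2) p])
qed

lemma pseudo_graph_delete_verts:
  assumes "pseudo_graph G"
  shows "pseudo_graph (delete_verts G S)"
proof -
  interpret pseudo_graph G by fact
  have "induced_subgraph (delete_verts G S) G"
    unfolding delete_verts_def by (rule induced_induce) auto
  then have "symmetric (delete_verts G S)"
    by (rule induced_graph_imp_symmetric[OF sym_arcs])
  then show ?thesis
    by unfold_locales (auto simp: delete_verts_def)
qed

lemma nomulti_digraph_delete_verts:
  assumes "nomulti_digraph G"
  shows "nomulti_digraph (delete_verts G S)"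
proof -
  interpret nomulti_digraph G by fact
  show ?thesis
    by unfold_locales (auto simp: delete_verts_def intro: no_multi_arcs)
qed

text \<open>The infeasible paths can be added to the sum, since each contributes a vanishing
  determinant; the full path expansion then applies.\<close>

lemma feasible_paths_sum:
  assumes "pseudo_graph G" and "nomulti_digraph G" and xy: "x \<in> verts G" "y \<in> verts G"
  shows "(\<Sum>p\<in>feasible_paths G x y. (-1) ^ vwalk_length p * graph_det (delete_verts G (set p))) =
    set_det (verts G) ((adjacency G)(y := unit_row x))"
proof -
  interpret pseudo_graph G by fact
  have "(\<Sum>p\<in>feasible_paths G x y. (-1) ^ vwalk_length p * graph_det (delete_verts G (set p))) =
    (\<Sum>p\<in>paths_on (arcs_ends G) (verts G) x y. (-1) ^ vwalk_length p * graph_det (delete_verts G (set p)))"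
  proof (rule sum.mono_neutral_left)
    show "finite (paths_on (arcs_ends G) (verts G) x y)" by (simp add: finite_paths_on)
    show "feasible_paths G x y \<subseteq> paths_on (arcs_ends G) (verts G) x y"
      by (auto simp: feasible_paths_def paths_on_def vpath_def vwalk_def)
    show "\<forall>p\<in>paths_on (arcs_ends G) (verts G) x y - feasible_paths G x y.
      (-1) ^ vwalk_length p * graph_det (delete_verts G (set p)) = 0"
    proof
      fix p assume "p \<in> paths_on (arcs_ends G) (verts G) x y - feasible_paths G x y"
      then have "\<nexists>M. perfect_2_matching M (delete_verts G (set p))"
        by (auto simp: feasible_paths_def paths_on_def vpath_def vwalk_def)
      then have "graph_det (delete_verts G (set p)) = 0"
        using perfect_2_matching_if_det_nonzero pseudo_graph_delete_verts[OF assms(1)]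
          nomulti_digraph_delete_verts[OF assms(2)] by blast
      then show "(-1) ^ vwalk_length p * graph_det (delete_verts G (set p)) = 0" by simp
    qed
  qed
  also have "\<dots> = set_det (verts G) ((adjacency G)(y := unit_row x))"
    by (subst set_det_adjugate_paths[of _ "arcs_ends G"])
       (use xy in \<open>auto simp: adjacency_def graph_det_delete_verts\<close>)
  finally show ?thesis .
qed

section \<open>Integrality of determinants and the equivalence\<close>

lemma det_Ints:
  fixes A :: "'a::comm_ring_1 mat"
  assumes "elements_mat A \<subseteq> \<int>"
  shows "det A \<in> \<int>"
\<comment> \<open>A non-square matrix has determinant 0 by definition.\<close>
proof (cases "dim_row A = dim_col A")
  case True
  have "A $$ (i, p i) \<in> \<int>" if "p permutes {0..<dim_row A}" "i < dim_row A" for p i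
  proof (rule subsetD[OF assms elements_matI[of A "dim_row A" "dim_row A" i "p i"]])
    show "A \<in> carrier_mat (dim_row A) (dim_row A)" using True by auto
    show "p i < dim_row A" using that permutes_in_image[OF that(1), of i] by simp
  qed (use that in auto)
  then show ?thesis
    using True by (auto simp: det_def intro!: Ints_sum Ints_mult Ints_prod)
qed (simp add: det_def)

theorem theorem3p2:
  fixes G :: "('a, 'b) pre_digraph"
  assumes "pseudo_graph G" and "nomulti_digraph G"
  shows "sign_invertible G \<longleftrightarrow>
    \<bar>graph_det G\<bar> = 1 \<and>
    (\<forall>x \<in> verts G. \<forall>y \<in> verts G.
       \<bar>\<Sum>p \<in> feasible_paths G x y.
          (-1) ^ vwalk_length p * graph_det (delete_verts G (set p))\<bar> \<in> {0, 1})"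
proof -
  interpret pseudo_graph G by fact
  define vs where "vs = vertex_enum G"
  define n where "n = length vs"
  define a where "a = adjacency G"
  define A where "A = adjacency_mat G"
  define D where "D = graph_det G"
  \<comment> \<open>\<open>C\<close> is the adjugate and \<open>B\<close> the candidate inverse. For
    \<open>D = 0\<close> division makes \<open>B\<close> zero, so \<open>AB\<close> asks for
    \<open>D \<noteq> 0\<close>.\<close>
  define C where "C x y = set_det (verts G) (a(y := unit_row x))" for x y
  define B where "B = mat n n (\<lambda>(i, j). C (vs ! i) (vs ! j) / D)"
  have vs: "distinct vs" "set vs = verts G"
    unfolding vs_def using vertex_enum[OF finite_verts] by auto
  have A: "A \<in> carrier_mat n n" and B: "B \<in> carrier_mat n n"
    by (auto simp: A_def B_def adjacency_mat_alt n_def vs_def)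
  have AB: "A * B = 1\<^sub>m n" if "D \<noteq> 0"
    using mat_nth_adjugate[of vs a] that vs
    unfolding A_def B_def adjacency_mat_alt C_def D_def graph_det_eq_set_det[OF finite_verts]
      n_def vs_def a_def by simp
  \<comment> \<open>Dividing by a determinant of absolute value 1 changes at most the sign of an
    entry.\<close>
  have B_elems: "elements_mat B \<subseteq> {-1, 0, 1} \<longleftrightarrow>
    (\<forall>x\<in>verts G. \<forall>y\<in>verts G. \<bar>C x y\<bar> \<in> {0, 1})" if D: "\<bar>D\<bar> = 1"
  proof -
    have *: "c / D \<in> {-1, 0, 1} \<longleftrightarrow> \<bar>c\<bar> \<in> {0, 1}" for c
      using D by (auto simp: abs_if field_simps split: if_splits)
    have "elements_mat B = {C x y / D | x y. x \<in> verts G \<and> y \<in> verts G}"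
      unfolding vs(2)[symmetric] elements_mat_def B_def n_def in_set_conv_nth by fastforce
    moreover have "{C x y / D | x y. x \<in> verts G \<and> y \<in> verts G} \<subseteq> {-1, 0, 1} \<longleftrightarrow>
      (\<forall>x\<in>verts G. \<forall>y\<in>verts G. C x y / D \<in> {-1, 0, 1})" by blast
    ultimately show ?thesis unfolding * by simp
  qed
  have "sign_invertible G \<longleftrightarrow> \<bar>D\<bar> = 1 \<and> elements_mat B \<subseteq> {-1, 0, 1}"
  proof
    assume "sign_invertible G"
    then obtain B' where inv: "inverts_mat A B'" "inverts_mat B' A" and el: "elements_mat B' \<subseteq> {-1, 0, 1}"
      by (auto simp: sign_invertible_def A_def)
    \<comment> \<open>\<open>inverts_mat\<close> does not fix the size of \<open>B'\<close>;
      comparing dimensions in both products does.\<close>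
    have "dim_col (A * B') = n" "dim_col (B' * A) = dim_row B'"
      using inv A by (auto simp: inverts_mat_def)
    then have B': "B' \<in> carrier_mat n n" using A by auto
    then have AB': "A * B' = 1\<^sub>m n" and B'A: "B' * A = 1\<^sub>m n"
      using inv A by (auto simp: inverts_mat_def)
    have "D * det B' = 1"
      using det_mult[OF A B'] AB' by (simp add: D_def graph_det_def A_def)
    moreover have "D \<in> \<int>" unfolding D_def graph_det_def
      by (rule det_Ints) (auto simp: adjacency_mat_alt adjacency_def elements_mat_def)
    moreover have "det B' \<in> \<int>"
      by (rule det_Ints) (use el in auto)
    \<comment> \<open>Two integers with product 1 are both 1 or both -1.\<close>
    ultimately obtain k l :: int where "real_of_int k * real_of_int l = 1" "D = k"
      by (auto elim!: Ints_cases)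
    then have D: "\<bar>D\<bar> = 1"
      by (metis abs_mult abs_zmult_eq_1 of_int_1 of_int_abs of_int_eq_iff of_int_mult abs_1)
    \<comment> \<open>Uniqueness of the inverse carries the entry bound from \<open>B'\<close> over
      to \<open>B\<close>.\<close>
    then have "B' = B' * (A * B)" using B' AB by auto
    also have "\<dots> = B" using B'A A B B' by (simp add: assoc_mult_mat[symmetric])
    finally show "\<bar>D\<bar> = 1 \<and> elements_mat B \<subseteq> {-1, 0, 1}" using D el by simp
  next
    assume *: "\<bar>D\<bar> = 1 \<and> elements_mat B \<subseteq> {-1, 0, 1}"
    then have "A * B = 1\<^sub>m n" using AB by auto
    \<comment> \<open>For square matrices over a field a right inverse is also a left
      inverse.\<close>
    moreover from this have "B * A = 1\<^sub>m n" by (rule mat_mult_left_right_inverse[OF A B])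
    ultimately show "sign_invertible G"
      using * A B unfolding sign_invertible_def inverts_mat_def A_def[symmetric] by auto
  qed
  then show ?thesis
    using B_elems feasible_paths_sum[OF assms] by (auto simp: C_def a_def D_def)
qed

end
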